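(* Let $C$ be a closed cone, not necessarily proper, in a real or complex Banach space. Let $X$ be a real or complex Banach space, not necessarily over the same field as the surrounding space of $C$, and let $T:C\to X$ be a continuous additive positively homogeneous map. Then the following are equivalent: (1) $T$ is surjective; (2) there exists a constant $K>0$ such that, for every $x\in X$, there exists some $c\in C$ with $x=Tc$ and $\|c\|\leq K\|x\|$; (3) $T$ is an open map; (4) $0$ is an interior point of $T(C)$.
   Context: A non-empty subset $C$ of a real or complex vector space is a cone if $C+C\subseteq C$ and $\lambda C\subseteq C$ for all real $\lambda\geq 0$; it is proper if $C\cap(-C)=\{0\}$ (not assumed here). $C$ carries the topology induced by the norm of the surrounding space. A map $T:C\to X$ is additive if $T(u+v)=Tu+Tv$ for all $u,v\in C$, and positively homogeneous if $T(\lambda u)=\lambda Tu$ for all $u\in C$ and all real $\lambda\geq0$. $T$ is an open map if it maps (relatively) open subsets of $C$ to open subsets of $X$. *)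

theory Defs
  imports "HOL-Analysis.Analysis"
begin

text \<open>
  The class \<^class>\<open>banach\<close> covers Banach spaces over the reals and over the complex numbers: a
  complex Banach space is in particular a complete real normed space with the same norm, and only
  multiplication by nonnegative real scalars occurs below. Two independent type variables of this
  class therefore also allow two spaces over different fields.
\<close>

text \<open>
  Unlike the library's predicate \<^const>\<open>cone\<close>, this demands non-emptiness and closure under addition.
\<close>

definition is_cone :: "'a::real_vector set \<Rightarrow> bool" where
  "is_cone C \<longleftrightarrow>
     C \<noteq> {} \<and> (\<forall>u\<in>C. \<forall>v\<in>C. u + v \<in> C) \<and> (\<forall>l::real. l \<ge> 0 \<longrightarrow> (\<forall>u\<in>C. l *\<^sub>R u \<in> C))"

text \<open>
  Maps \<open>C \<rightarrow> X\<close> are total functions of which only the values on \<open>C\<close> matter.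
\<close>

definition additive_on :: "'a::real_vector set \<Rightarrow> ('a \<Rightarrow> 'b::real_vector) \<Rightarrow> bool" where
  "additive_on C T \<longleftrightarrow> (\<forall>u\<in>C. \<forall>v\<in>C. T (u + v) = T u + T v)"

definition pos_homogeneous_on :: "'a::real_vector set \<Rightarrow> ('a \<Rightarrow> 'b::real_vector) \<Rightarrow> bool" where
  "pos_homogeneous_on C T \<longleftrightarrow> (\<forall>u\<in>C. \<forall>l::real. l \<ge> 0 \<longrightarrow> T (l *\<^sub>R u) = l *\<^sub>R T u)"

end

theory Submission
  imports Defs
begin

text \<open>
  The hard implication is that surjectivity yields a linear bound on preimages; it follows Banach's
  proof of the open mapping theorem, in which subtraction has to be avoided since \<open>C\<close> need not
  contain the negatives of its elements.

  By surjectivity, the images of the truncated cones \<open>{c \<in> C. \<parallel>c\<parallel> \<le> n}\<close> cover the Banach space \<open>X\<close>,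
  so by Baire's theorem the closure of one of them contains a ball around some \<open>y\<close>. In the linear
  case this ball is moved to the origin by subtracting a preimage of \<open>y\<close>. Here one adds instead a
  preimage of \<open>-y\<close>, which exists by surjectivity, and gets a ball around the origin in the
  closure of the image of a larger truncated cone. By homogeneity every \<open>x\<close> is then approximated
  up to an error \<open>\<parallel>x\<parallel>/2\<close> by an image \<open>T c\<close> with \<open>\<parallel>c\<parallel> \<le> M\<parallel>x\<parallel>\<close> (\<open>approximate_preimage\<close>). Correcting
  the successive errors produces a series in \<open>C\<close> that converges absolutely; its partial sums lie in
  \<open>C\<close>, so its sum is in the closed set \<open>C\<close>, and continuity makes it an exact preimage of \<open>x\<close> of norm
  at most \<open>2M\<parallel>x\<parallel>\<close> (\<open>preimage_of_approximate\<close>).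

  The other implications are translations and scalings. To reach points near \<open>T u\<close> one adds to \<open>u\<close>
  a small element of \<open>C\<close>, so the linear bound makes \<open>T\<close> open; an open map sends \<open>C\<close>
  to an open set that contains \<open>T 0 = 0\<close>; and a neighbourhood of \<open>0\<close> in \<open>T(C)\<close> absorbs \<open>X\<close>,
  because \<open>T(C)\<close> is closed under scaling.
\<close>

section \<open>Countable covers of complete metric spaces\<close>

lemma countable_cover_somewhere_dense:
  fixes A :: "nat \<Rightarrow> 'a::complete_space set"
  assumes "(\<Union>n. A n) = UNIV"
  shows "\<exists>n. interior (closure (A n)) \<noteq> {}"
proof (rule ccontr)
  assume "\<not> ?thesis"
  then have "euclidean interior_of \<Union> (range (\<lambda>n. closure (A n))) = {}"
    by (intro Baire_category_alt) (auto simp: completely_metrizable_space_euclidean)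
  moreover have "(\<Union>n. closure (A n)) = UNIV"
    using assms closure_subset by blast
  ultimately show False
    by simp
qed

section \<open>Additive positively homogeneous maps on cones\<close>

locale conic_map =
  fixes C :: "'a::banach set" and T :: "'a \<Rightarrow> 'b::banach"
  assumes cone: "is_cone C"
    and additive: "additive_on C T"
    and homogeneous: "pos_homogeneous_on C T"
begin

lemma add_mem: "u \<in> C \<Longrightarrow> v \<in> C \<Longrightarrow> u + v \<in> C"
  using cone by (auto simp: is_cone_def)

lemma scaleR_mem: "u \<in> C \<Longrightarrow> 0 \<le> l \<Longrightarrow> l *\<^sub>R u \<in> C"
  using cone by (auto simp: is_cone_def)

lemma zero_mem: "0 \<in> C"
  using cone scaleR_mem[of _ 0] by (auto simp: is_cone_def)

lemma map_add: "u \<in> C \<Longrightarrow> v \<in> C \<Longrightarrow> T (u + v) = T u + T v"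
  using additive by (auto simp: additive_on_def)

lemma map_scaleR: "u \<in> C \<Longrightarrow> 0 \<le> l \<Longrightarrow> T (l *\<^sub>R u) = l *\<^sub>R T u"
  using homogeneous by (auto simp: pos_homogeneous_on_def)

lemma map_zero: "T 0 = 0"
  using map_scaleR[OF zero_mem, of 0] by simp

lemma sum_mem: "(\<And>i. i \<in> I \<Longrightarrow> c i \<in> C) \<Longrightarrow> sum c I \<in> C"
  by (induction I rule: infinite_finite_induct) (auto simp: zero_mem add_mem)

section \<open>Linear bound on preimages under a surjection\<close>

text \<open>
  Successive approximation: the residuals \<open>r\<^sub>0 = x\<close>, \<open>r\<^sub>k\<^sub>+\<^sub>1 = r\<^sub>k - T c\<^sub>k\<close> have norm at most
  \<open>\<parallel>x\<parallel>/2\<^sup>k\<close>, hence the corrections \<open>c\<^sub>k\<close> form a series in \<open>C\<close> dominated by the geometric series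
  \<open>M\<parallel>x\<parallel>/2\<^sup>k\<close>. Completeness of the domain gives the sum, closedness keeps it in \<open>C\<close>, and continuity
  passes \<open>T (c\<^sub>0 + \<dots> + c\<^sub>n\<^sub>-\<^sub>1) = x - r\<^sub>n\<close> to the limit.
\<close>

lemma preimage_of_approximate:
  assumes "closed C" "continuous_on C T"
    and approx: "\<And>y. \<exists>c\<in>C. norm c \<le> M * norm y \<and> norm (y - T c) \<le> norm y / 2"
    and "0 \<le> M"
  shows "\<exists>c\<in>C. x = T c \<and> norm c \<le> 2 * M * norm x"
proof -
  obtain g where g: "\<And>y. g y \<in> C" "\<And>y. norm (g y) \<le> M * norm y"
      "\<And>y. norm (y - T (g y)) \<le> norm y / 2"
    using approx by metis
  define r where "r k = ((\<lambda>y. y - T (g y)) ^^ k) x" for k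
  define c where "c k = g (r k)" for k
  have r0: "r 0 = x" and rSuc: "r (Suc k) = r k - T (c k)" for k
    by (simp_all add: r_def c_def)
  have norm_r: "norm (r k) \<le> norm x * (1 / 2) ^ k" for k
  proof (induction k)
    case (Suc k)
    then show ?case
      using g(3)[of "r k"] by (simp add: rSuc c_def)
  qed (simp add: r0)
  have c_mem: "c k \<in> C" for k
    by (simp add: c_def g(1))
  have norm_c: "norm (c k) \<le> M * norm x * (1 / 2) ^ k" for k
    using g(2)[of "r k"] mult_left_mono[OF norm_r[of k] \<open>0 \<le> M\<close>] by (simp add: c_def)
  have geometric: "summable (\<lambda>k. M * norm x * (1 / 2 :: real) ^ k)"
    by (intro summable_mult) simp
  have summable_c: "summable c"
    by (rule summable_comparison_test'[OF geometric, of 0]) (rule norm_c)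
  have norm_suminf: "norm (suminf c) \<le> 2 * M * norm x"
    using norm_suminf_le[of c, OF norm_c geometric]
    by (simp add: suminf_mult suminf_geometric)
  have partial_mem: "(\<Sum>k<n. c k) \<in> C" for n
    by (intro sum_mem c_mem)
  have partial_limit: "(\<lambda>n. \<Sum>k<n. c k) \<longlonglongrightarrow> suminf c"
    by (rule summable_LIMSEQ[OF summable_c])
  then have suminf_mem: "suminf c \<in> C"
    using closed_sequentially[OF \<open>closed C\<close>, of "\<lambda>n. \<Sum>k<n. c k"] partial_mem by blast
  have "(\<lambda>n. T (\<Sum>k<n. c k)) \<longlonglongrightarrow> T (suminf c)"
    by (rule continuous_on_tendsto_compose[OF \<open>continuous_on C T\<close> partial_limit suminf_mem])
       (simp add: partial_mem)
  moreover have "T (\<Sum>k<n. c k) = x - r n" for n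
  proof (induction n)
    case (Suc n)
    then show ?case
      by (simp add: map_add[OF partial_mem c_mem] rSuc)
  qed (simp add: map_zero r0)
  moreover have "r \<longlonglongrightarrow> 0"
  proof (rule Lim_null_comparison)
    show "\<forall>\<^sub>F n in sequentially. norm (r n) \<le> norm x * (1 / 2) ^ n"
      by (simp add: norm_r)
    show "(\<lambda>n. norm x * (1 / 2 :: real) ^ n) \<longlonglongrightarrow> 0"
      by (intro tendsto_mult_right_zero LIMSEQ_power_zero) simp
  qed
  then have "(\<lambda>n. x - r n) \<longlonglongrightarrow> x"
    using tendsto_diff[OF tendsto_const[of x]] by fastforce
  ultimately have "x = T (suminf c)"
    by (simp add: LIMSEQ_unique)
  then show ?thesis
    using suminf_mem norm_suminf by blast
qed

text \<open>
  Adding a preimage of \<open>-y\<close> to the elements that approximate the points near \<open>y\<close> is what replaces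
  the subtraction of the classical proof.
\<close>

lemma ball_in_closure_of_truncated_image:
  assumes "T ` C = UNIV"
  shows "\<exists>M r. 0 \<le> M \<and> 0 < r \<and> ball 0 r \<subseteq> closure (T ` (C \<inter> cball 0 M))"
proof -
  have "(\<Union>n::nat. T ` (C \<inter> cball 0 (real n))) = UNIV"
  proof -
    have "x \<in> (\<Union>n::nat. T ` (C \<inter> cball 0 (real n)))" for x
    proof -
      obtain c where "c \<in> C" "x = T c"
        using assms by blast
      moreover obtain n :: nat where "norm c \<le> real n"
        using real_arch_simple by blast
      ultimately show ?thesis
        by (intro UN_I[of n]) auto
    qed
    then show ?thesis
      by blast
  qed
  then obtain n :: nat where "interior (closure (T ` (C \<inter> cball 0 (real n)))) \<noteq> {}"
    using countable_cover_somewhere_dense by blast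
  then obtain y r where r: "0 < r" "ball y r \<subseteq> closure (T ` (C \<inter> cball 0 (real n)))"
    by (meson ex_in_conv mem_interior)
  obtain d where d: "d \<in> C" "T d = - y"
    using assms by (metis UNIV_I imageE)
  have "z \<in> closure (T ` (C \<inter> cball 0 (real n + norm d)))" if "z \<in> ball 0 r" for z
    unfolding closure_approachable
  proof (intro allI impI)
    fix e :: real
    assume "0 < e"
    have "y + z \<in> ball y r"
      using that by (simp add: dist_norm)
    then obtain c where c: "c \<in> C" "norm c \<le> real n" "dist (T c) (y + z) < e"
      using r(2) \<open>0 < e\<close> by (force simp: closure_approachable)
    have "T (c + d) - z = T c - (y + z)"
      by (simp add: map_add c(1) d)
    then have "dist (T (c + d)) z < e"
      using c(3) by (simp only: dist_norm)
    moreover have "c + d \<in> C \<inter> cball 0 (real n + norm d)"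
      using c d norm_triangle_ineq[of c d] by (simp add: add_mem)
    ultimately show "\<exists>w\<in>T ` (C \<inter> cball 0 (real n + norm d)). dist w z < e"
      by blast
  qed
  then show ?thesis
    using r(1) by (intro exI[of _ "real n + norm d"] exI[of _ r]) auto
qed

lemma approximate_preimage:
  assumes "T ` C = UNIV"
  shows "\<exists>M\<ge>0. \<forall>x. \<exists>c\<in>C. norm c \<le> M * norm x \<and> norm (x - T c) \<le> norm x / 2"
proof -
  obtain M r where M: "0 \<le> M" and r: "0 < r"
    and ball: "ball 0 r \<subseteq> closure (T ` (C \<inter> cball 0 M))"
    using ball_in_closure_of_truncated_image[OF assms] by blast
  have "\<exists>c\<in>C. norm c \<le> 2 * M / r * norm x \<and> norm (x - T c) \<le> norm x / 2" for x
  proof (cases "x = 0")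
    case True
    then show ?thesis
      using zero_mem map_zero by force
  next
    case False
    \<comment> \<open>\<open>x\<close> is scaled to norm \<open>r/2\<close>, hence into the ball; scaling back by \<open>s = 2\<parallel>x\<parallel>/r\<close> turns an
      error of \<open>r/4\<close> into \<open>\<parallel>x\<parallel>/2\<close>.\<close>
    define s where "s = 2 * norm x / r"
    have s: "0 < s"
      using False r by (simp add: s_def)
    have "x /\<^sub>R s \<in> ball 0 r"
      using False r s by (simp add: s_def field_simps)
    then have "\<exists>w\<in>T ` (C \<inter> cball 0 M). dist w (x /\<^sub>R s) < r / 4"
      using ball r by (meson closure_approachable divide_pos_pos subsetD zero_less_numeral)
    then obtain c where c: "c \<in> C" "norm c \<le> M" "norm (T c - x /\<^sub>R s) < r / 4"
      by (auto simp: dist_norm)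
    have "x - T (s *\<^sub>R c) = - (s *\<^sub>R (T c - x /\<^sub>R s))"
      using s by (simp add: map_scaleR c(1) algebra_simps)
    then have "norm (x - T (s *\<^sub>R c)) = s * norm (T c - x /\<^sub>R s)"
      using s by simp
    also have "\<dots> \<le> s * (r / 4)"
      using c(3) s by (intro mult_left_mono) auto
    also have "\<dots> = norm x / 2"
      using r by (simp add: s_def)
    finally have "norm (x - T (s *\<^sub>R c)) \<le> norm x / 2" .
    moreover have "norm (s *\<^sub>R c) \<le> 2 * M / r * norm x"
      using mult_left_mono[OF c(2), of s] s r by (simp add: s_def field_simps)
    ultimately show ?thesis
      using scaleR_mem[OF c(1), of s] s by (intro bexI[of _ "s *\<^sub>R c"]) auto
  qed
  then show ?thesis
    using M r by (intro exI[of _ "2 * M / r"]) auto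
qed

lemma bounded_preimages_of_surj:
  assumes "closed C" "continuous_on C T" "T ` C = UNIV"
  shows "\<exists>K>0. \<forall>x. \<exists>c\<in>C. x = T c \<and> norm c \<le> K * norm x"
proof -
  obtain M where M: "0 \<le> M"
    and approx: "\<And>x. \<exists>c\<in>C. norm c \<le> M * norm x \<and> norm (x - T c) \<le> norm x / 2"
    using approximate_preimage[OF assms(3)] by blast
  \<comment> \<open>The summand \<open>1\<close> makes the constant positive even if \<open>M = 0\<close>, as when \<open>X = {0}\<close>.\<close>
  have "\<exists>c\<in>C. x = T c \<and> norm c \<le> (2 * M + 1) * norm x" for x
  proof -
    obtain c where "c \<in> C" "x = T c" "norm c \<le> 2 * M * norm x"
      using preimage_of_approximate[OF assms(1,2) approx M] by blast
    moreover have "2 * M * norm x \<le> (2 * M + 1) * norm x"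
      by (intro mult_right_mono) auto
    ultimately show ?thesis
      by force
  qed
  then show ?thesis
    using M by (intro exI[of _ "2 * M + 1"]) auto
qed

section \<open>Openness and neighbourhoods of the origin\<close>

lemma open_map_of_bounded_preimages:
  assumes "0 < K" and bound: "\<And>x. \<exists>c\<in>C. x = T c \<and> norm c \<le> K * norm x"
  shows "open_map (top_of_set C) euclidean T"
  unfolding open_map_def open_openin[symmetric]
proof (intro allI impI)
  fix U
  assume U: "openin (top_of_set C) U"
  then have "U \<subseteq> C"
    by (rule openin_imp_subset)
  show "open (T ` U)"
    unfolding open_contains_ball
  proof
    fix y
    assume "y \<in> T ` U"
    then obtain u where u: "u \<in> U" "y = T u"
      by blast
    then obtain e where e: "0 < e" "ball u e \<inter> C \<subseteq> U"
      using U by (auto simp: openin_contains_ball)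
    have "z \<in> T ` U" if "z \<in> ball y (e / K)" for z
    proof -
      obtain c where c: "c \<in> C" "z - y = T c" "norm c \<le> K * norm (z - y)"
        using bound by blast
      have "K * norm (z - y) < e"
        using that \<open>0 < K\<close> by (simp add: dist_norm norm_minus_commute field_simps)
      then have "u + c \<in> ball u e \<inter> C"
        using c u(1) \<open>U \<subseteq> C\<close> by (auto simp: dist_norm add_mem)
      moreover have "z = T (u + c)"
        using c u \<open>U \<subseteq> C\<close> map_add[of u c] by (auto simp: algebra_simps)
      ultimately show ?thesis
        using e(2) by blast
    qed
    then show "\<exists>d>0. ball y d \<subseteq> T ` U"
      using e(1) \<open>0 < K\<close> by (intro exI[of _ "e / K"]) auto
  qed
qed

lemma zero_interior_of_open_map:
  assumes "open_map (top_of_set C) euclidean T"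
  shows "0 \<in> interior (T ` C)"
proof -
  have "open (T ` C)"
    using assms by (auto simp: open_map_def)
  moreover have "0 \<in> T ` C"
    using zero_mem map_zero by force
  ultimately show ?thesis
    by (simp add: interior_open)
qed

lemma surj_of_zero_interior:
  assumes "0 \<in> interior (T ` C)"
  shows "T ` C = UNIV"
proof -
  obtain r where r: "0 < r" "cball 0 r \<subseteq> T ` C"
    using assms by (auto simp: mem_interior_cball)
  have "x \<in> T ` C" for x
  proof (cases "x = 0")
    case True
    then show ?thesis
      using zero_mem map_zero by force
  next
    case False
    define s where "s = norm x / r"
    have s: "0 < s"
      using False r by (simp add: s_def)
    have "x /\<^sub>R s \<in> cball 0 r"
      using False r(1) by (simp add: s_def)
    then obtain c where c: "c \<in> C" "x /\<^sub>R s = T c"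
      using r(2) by blast
    then have "T (s *\<^sub>R c) = x"
      using s by (simp add: map_scaleR flip: c(2))
    then show ?thesis
      using scaleR_mem[OF c(1), of s] s by force
  qed
  then show ?thesis
    by blast
qed

end

section \<open>The open mapping theorem for cones\<close>

theorem theorem1p2:
  fixes C :: "'a::banach set" and T :: "'a \<Rightarrow> 'b::banach"
  assumes "is_cone C" and "closed C"
    and "continuous_on C T" and "additive_on C T" and "pos_homogeneous_on C T"
  shows
    "(T ` C = UNIV \<longleftrightarrow> (\<exists>K::real>0. \<forall>x. \<exists>c\<in>C. x = T c \<and> norm c \<le> K * norm x)) \<and>
     ((\<exists>K::real>0. \<forall>x. \<exists>c\<in>C. x = T c \<and> norm c \<le> K * norm x) \<longleftrightarrow>
        open_map (top_of_set C) euclidean T) \<and>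
     (open_map (top_of_set C) euclidean T \<longleftrightarrow> 0 \<in> interior (T ` C))"
proof -
  interpret conic_map C T
    using assms by unfold_locales
  have "T ` C = UNIV \<Longrightarrow> \<exists>K>0. \<forall>x. \<exists>c\<in>C. x = T c \<and> norm c \<le> K * norm x"
    by (rule bounded_preimages_of_surj[OF \<open>closed C\<close> \<open>continuous_on C T\<close>])
  moreover have "\<exists>K>0. \<forall>x. \<exists>c\<in>C. x = T c \<and> norm c \<le> K * norm x \<Longrightarrow>
      open_map (top_of_set C) euclidean T"
    using open_map_of_bounded_preimages by blast
  ultimately show ?thesis
    using zero_interior_of_open_map surj_of_zero_interior by argo
qed

end
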